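(* Suppose the boundary conditions (I)–(II) are co-normal with respect to $l$. For $L$ positive definite in $\mathcal{L}^2(G)$ and $y$ an eigenfunction of the boundary-value problem $-y''+qy=\lambda By$ on $G$ with boundary conditions (I)–(II), corresponding to the eigenvalue $\lambda$, we have $y\in C^+$ if and only if $\lambda>0$, and $y\in C^-$ if and only if $\lambda<0$.
   Context: Graph and spaces. $G$ is an oriented graph with finitely many edges $e_1,\dots,e_K$, each of length $1$; $e_i$ is identified with $[0,1]$, with $0$ the initial and $1$ the terminal point. A complex-valued function $y$ on $G$ is a tuple $(y_1,\dots,y_K)$ with $y_i=y|_{e_i}$ a function on $[0,1]$. Put $\mathcal{L}^2(G)=\bigoplus_{i=1}^K L^2(0,1)$ and $\mathcal{H}^m(G)=\bigoplus_{i=1}^K H^m(0,1)$ (Sobolev spaces), $\int_G h\,dt=\sum_i\int_0^1 h_i\,dt$, $(f,g)=\int_G f\bar g\,dt$, $\|f\|^2=(f,f)$. Equation. $q$ is real-valued and essentially bounded on $G$; $b=1$ on the edges $e_1,\dots,e_p$ and $b=-1$ on $e_{p+1},\dots,e_K$; $(By)(x)=b(x)y(x)$; $ly=-y''+qy$. An eigenfunction is a nonzero solution $y\in\mathcal{H}^2(G)$ of the boundary-value problem. Cones. $[f,g]=(Bf,g)$ is an indefinite inner product on $\mathcal{L}^2(G)$; $\mathcal{L}^2(G)$ with $[\cdot,\cdot]$ is a Krein space $H_K$. $C^+=\{y\in H_K:[y,y]>0\}$ and $C^-=\{y\in H_K:[y,y]<0\}$. Boundary conditions. At the nodes of $G$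 one imposes in total $2K$ linearly independent linear homogeneous conditions with constant coefficients, each involving only the values of $y$ and $y'$ at the edge ends incident to one node, which are formally self-adjoint, i.e. $(lx,y)=(x,ly)$ for all $x,y\in\mathcal{H}^2(G)$ satisfying the conditions. They are written as (I) $\sum_{j=1}^K[\alpha_{ij}y_j(0)+\gamma_{ij}y_j(1)]=0$, $i=1,\dots,J$; (II) $\sum_{j=1}^K[\alpha_{ij}y_j(0)+\beta_{ij}y_j'(0)+\gamma_{ij}y_j(1)+\delta_{ij}y_j'(1)]=0$, $i=J+1,\dots,2K$, where all Dirichlet-like conditions are in (I), that is, every linear combination of (I)–(II) containing no derivative terms is a linear combination of the conditions (I) alone. Operator. $Lf=-f''+qf$ with domain $\mathcal{D}(L)=\{f: f,f'\in AC,\ Lf\in\mathcal{L}^2(G),\ f\text{ satisfies (I) and (II)}\}$, a self-adjoint operator in $\mathcal{L}^2(G)$. $L$ positive definite means $(Ly,y)>0$ for all $y\in\mathcal{D}(L)\setminus\{0\}$. Co-normal conditions. $\mathcal{D}(F)=\{y\in\mathcal{H}^1(G): y \text{ satisfies (I)}\}$. For a function $y$ on the set $\partial G$ of the $2K$ edge ends, $\int_{\partial G}y\,d\sigma=\sum_{i=1}^K[y_i(1)-y_i(0)]$. The boundary conditions are called co-normal (or elliptic) with respect to $l$ if there is a function $f$ on $\partial G$ (one scalar for each of the $2K$ edge ends) such that, for $x\in\mathcal{D}(F)\cap\mathcal{H}^2(G)$, one has $\int_{\partial G}(fx+x')\bar y\,d\sigma=0$ for all $y\in\mathcal{D}(F)$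 if and only if $x$ satisfies (II). *)

theory Defs
  imports
    "HOL-Analysis.Analysis"
    "HOL-Library.Complex_Order"
    "Graph_Theory.Digraph"
begin

text \<open>
  A function on the graph is a family \<open>y :: nat \<Rightarrow> real \<Rightarrow> complex\<close>; only the values \<open>y i t\<close> with
  \<open>i \<in> {1..K}\<close> (the edge) and \<open>t \<in> {0..1}\<close> (the point on it) are relevant. An edge end is a pair
  \<open>(i, t)\<close> with \<open>t = 0\<close> (the tail of the edge) or \<open>t = 1\<close> (the head).

  The order on the complex numbers is that of \<open>Complex_Order\<close>: \<open>0 < z\<close> says that \<open>z\<close> is real and
  positive.
\<close>

type_synonym graph_fun = "nat \<Rightarrow> real \<Rightarrow> complex"
type_synonym coeffs = "nat \<Rightarrow> nat \<Rightarrow> complex"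

subsection \<open>Function spaces on one edge\<close>

definition abs_cont_on :: "real set \<Rightarrow> (real \<Rightarrow> complex) \<Rightarrow> bool" where
  "abs_cont_on S f \<longleftrightarrow>
     (\<forall>\<epsilon>>0. \<exists>\<delta>>0. \<forall>(n::nat) (a::nat \<Rightarrow> real) (b::nat \<Rightarrow> real).
        (\<forall>k<n. a k \<in> S \<and> b k \<in> S \<and> a k \<le> b k) \<and>
        (\<forall>k<n. \<forall>l<n. k \<noteq> l \<longrightarrow> {a k<..<b k} \<inter> {a l<..<b l} = {}) \<and>
        (\<Sum>k<n. b k - a k) < \<delta>
        \<longrightarrow> (\<Sum>k<n. cmod (f (b k) - f (a k))) < \<epsilon>)"

text \<open>One-sided at the end points; where the derivative does not exist (a null set, in all uses
  below) the value is arbitrary.\<close>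
definition edge_deriv :: "(real \<Rightarrow> complex) \<Rightarrow> real \<Rightarrow> complex" where
  "edge_deriv f t = vector_derivative f (at t within {0..1})"

definition L2_edge :: "(real \<Rightarrow> complex) \<Rightarrow> bool" where
  "L2_edge f \<longleftrightarrow> f \<in> borel_measurable (lebesgue_on {0..1}) \<and>
     integrable (lebesgue_on {0..1}) (\<lambda>t. (cmod (f t))\<^sup>2)"

text \<open>The Sobolev space \<open>H\<^sup>m(0,1)\<close>, each class being represented (for \<open>m \<ge> 1\<close>) by its unique
  continuous member, so that boundary values make sense: the derivatives of order below \<open>m\<close> are
  absolutely continuous on \<open>[0,1]\<close> and the one of order \<open>m\<close> is square integrable.\<close>
definition sobolev_edge :: "nat \<Rightarrow> (real \<Rightarrow> complex) \<Rightarrow> bool" where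
  "sobolev_edge m f \<longleftrightarrow>
     (\<forall>j<m. abs_cont_on {0..1} ((edge_deriv ^^ j) f)) \<and>
     (\<forall>j. Suc j < m \<longrightarrow> (edge_deriv ^^ j) f differentiable_on {0..1}) \<and>
     L2_edge ((edge_deriv ^^ m) f)"

subsection \<open>Function spaces on the graph\<close>

definition L2_graph :: "nat \<Rightarrow> graph_fun set" where
  "L2_graph K = {y. \<forall>i\<in>{1..K}. L2_edge (y i)}"

definition sobolev_graph :: "nat \<Rightarrow> nat \<Rightarrow> graph_fun set" where
  "sobolev_graph m K = {y. \<forall>i\<in>{1..K}. sobolev_edge m (y i)}"

definition zero_graph_fun :: "nat \<Rightarrow> graph_fun \<Rightarrow> bool" where
  "zero_graph_fun K y \<longleftrightarrow> (\<forall>i\<in>{1..K}. \<forall>t\<in>{0..1}. y i t = 0)"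

definition graph_integral :: "nat \<Rightarrow> graph_fun \<Rightarrow> complex" where
  "graph_integral K h = (\<Sum>i=1..K. integral\<^sup>L (lebesgue_on {0..1}) (h i))"

definition graph_inner :: "nat \<Rightarrow> graph_fun \<Rightarrow> graph_fun \<Rightarrow> complex" where
  "graph_inner K f g = graph_integral K (\<lambda>i t. f i t * cnj (g i t))"

definition boundary_integral :: "nat \<Rightarrow> graph_fun \<Rightarrow> complex" where
  "boundary_integral K h = (\<Sum>i=1..K. h i 1 - h i 0)"

subsection \<open>The equation and the indefinite inner product\<close>

definition ess_bounded :: "nat \<Rightarrow> (nat \<Rightarrow> real \<Rightarrow> real) \<Rightarrow> bool" where
  "ess_bounded K q \<longleftrightarrow> (\<forall>i\<in>{1..K}. q i \<in> borel_measurable (lebesgue_on {0..1}) \<and>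
     (\<exists>C. AE t in lebesgue_on {0..1}. \<bar>q i t\<bar> \<le> C))"

definition weight_op :: "nat \<Rightarrow> graph_fun \<Rightarrow> graph_fun" where
  "weight_op p y = (\<lambda>i t. (if i \<le> p then 1 else - 1) * y i t)"

definition diff_expr :: "(nat \<Rightarrow> real \<Rightarrow> real) \<Rightarrow> graph_fun \<Rightarrow> graph_fun" where
  "diff_expr q y = (\<lambda>i t. - edge_deriv (edge_deriv (y i)) t + complex_of_real (q i t) * y i t)"

definition krein_inner :: "nat \<Rightarrow> nat \<Rightarrow> graph_fun \<Rightarrow> graph_fun \<Rightarrow> complex" where
  "krein_inner p K f g = graph_inner K (weight_op p f) g"

definition cone_pos :: "nat \<Rightarrow> nat \<Rightarrow> graph_fun set" where
  "cone_pos p K = {y \<in> L2_graph K. 0 < krein_inner p K y y}"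

definition cone_neg :: "nat \<Rightarrow> nat \<Rightarrow> graph_fun set" where
  "cone_neg p K = {y \<in> L2_graph K. krein_inner p K y y < 0}"

subsection \<open>Boundary conditions\<close>

text \<open>Row \<open>i\<close> of the coefficients: \<open>\<alpha> i j\<close>, \<open>\<beta> i j\<close> multiply \<open>y j\<close> and its derivative at \<open>0\<close>,
  \<open>\<gamma> i j\<close>, \<open>\<delta> i j\<close> those at \<open>1\<close>. Rows \<open>1..J\<close> form (I), where \<open>\<beta>\<close> and \<open>\<delta>\<close> are required to vanish
  in \<open>graph_bcs\<close>, and rows \<open>J+1..2K\<close> form (II).\<close>

definition sat_I :: "nat \<Rightarrow> nat \<Rightarrow> coeffs \<Rightarrow> coeffs \<Rightarrow> graph_fun \<Rightarrow> bool" where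
  "sat_I K J \<alpha> \<gamma> y \<longleftrightarrow>
     (\<forall>i\<in>{1..J}. (\<Sum>j=1..K. \<alpha> i j * y j 0 + \<gamma> i j * y j 1) = 0)"

definition sat_II ::
  "nat \<Rightarrow> nat \<Rightarrow> coeffs \<Rightarrow> coeffs \<Rightarrow> coeffs \<Rightarrow> coeffs \<Rightarrow> graph_fun \<Rightarrow> bool" where
  "sat_II K J \<alpha> \<beta> \<gamma> \<delta> y \<longleftrightarrow>
     (\<forall>i\<in>{J+1..2*K}. (\<Sum>j=1..K. \<alpha> i j * y j 0 + \<beta> i j * edge_deriv (y j) 0
                              + \<gamma> i j * y j 1 + \<delta> i j * edge_deriv (y j) 1) = 0)"

definition sat_bcs ::
  "nat \<Rightarrow> nat \<Rightarrow> coeffs \<Rightarrow> coeffs \<Rightarrow> coeffs \<Rightarrow> coeffs \<Rightarrow> graph_fun \<Rightarrow> bool" where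
  "sat_bcs K J \<alpha> \<beta> \<gamma> \<delta> y \<longleftrightarrow> sat_I K J \<alpha> \<gamma> y \<and> sat_II K J \<alpha> \<beta> \<gamma> \<delta> y"

definition lin_indep_bcs ::
  "nat \<Rightarrow> coeffs \<Rightarrow> coeffs \<Rightarrow> coeffs \<Rightarrow> coeffs \<Rightarrow> bool" where
  "lin_indep_bcs K \<alpha> \<beta> \<gamma> \<delta> \<longleftrightarrow>
     (\<forall>c :: nat \<Rightarrow> complex.
        (\<forall>j\<in>{1..K}. (\<Sum>i=1..2*K. c i * \<alpha> i j) = 0 \<and> (\<Sum>i=1..2*K. c i * \<beta> i j) = 0 \<and>
                    (\<Sum>i=1..2*K. c i * \<gamma> i j) = 0 \<and> (\<Sum>i=1..2*K. c i * \<delta> i j) = 0)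
        \<longrightarrow> (\<forall>i\<in>{1..2*K}. c i = 0))"

text \<open>Each condition involves only edge ends incident to one node.\<close>
definition local_bcs ::
  "('v, nat) pre_digraph \<Rightarrow> nat \<Rightarrow> coeffs \<Rightarrow> coeffs \<Rightarrow> coeffs \<Rightarrow> coeffs \<Rightarrow> bool" where
  "local_bcs G K \<alpha> \<beta> \<gamma> \<delta> \<longleftrightarrow>
     (\<forall>i\<in>{1..2*K}. \<exists>v\<in>verts G. \<forall>j\<in>{1..K}.
        (tail G j \<noteq> v \<longrightarrow> \<alpha> i j = 0 \<and> \<beta> i j = 0) \<and>
        (head G j \<noteq> v \<longrightarrow> \<gamma> i j = 0 \<and> \<delta> i j = 0))"

text \<open>Every linear combination of the conditions without derivative terms is a linear
  combination of the conditions (I).\<close>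
definition dirichlet_in_I ::
  "nat \<Rightarrow> nat \<Rightarrow> coeffs \<Rightarrow> coeffs \<Rightarrow> coeffs \<Rightarrow> coeffs \<Rightarrow> bool" where
  "dirichlet_in_I K J \<alpha> \<beta> \<gamma> \<delta> \<longleftrightarrow>
     (\<forall>c :: nat \<Rightarrow> complex.
        (\<forall>j\<in>{1..K}. (\<Sum>i=1..2*K. c i * \<beta> i j) = 0 \<and> (\<Sum>i=1..2*K. c i * \<delta> i j) = 0)
        \<longrightarrow> (\<exists>d :: nat \<Rightarrow> complex. \<forall>j\<in>{1..K}.
               (\<Sum>i=1..2*K. c i * \<alpha> i j) = (\<Sum>i=1..J. d i * \<alpha> i j) \<and>
               (\<Sum>i=1..2*K. c i * \<gamma> i j) = (\<Sum>i=1..J. d i * \<gamma> i j)))"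

definition graph_bcs ::
  "('v, nat) pre_digraph \<Rightarrow> nat \<Rightarrow> nat \<Rightarrow> coeffs \<Rightarrow> coeffs \<Rightarrow> coeffs \<Rightarrow> coeffs \<Rightarrow> bool" where
  "graph_bcs G K J \<alpha> \<beta> \<gamma> \<delta> \<longleftrightarrow>
     J \<le> 2 * K \<and>
     (\<forall>i\<in>{1..J}. \<forall>j\<in>{1..K}. \<beta> i j = 0 \<and> \<delta> i j = 0) \<and>
     lin_indep_bcs K \<alpha> \<beta> \<gamma> \<delta> \<and>
     local_bcs G K \<alpha> \<beta> \<gamma> \<delta> \<and>
     dirichlet_in_I K J \<alpha> \<beta> \<gamma> \<delta>"

definition formally_self_adjoint ::
  "nat \<Rightarrow> (nat \<Rightarrow> real \<Rightarrow> real) \<Rightarrow> nat \<Rightarrow> coeffs \<Rightarrow> coeffs \<Rightarrow> coeffs \<Rightarrow> coeffs \<Rightarrow> bool" where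
  "formally_self_adjoint K q J \<alpha> \<beta> \<gamma> \<delta> \<longleftrightarrow>
     (\<forall>x\<in>sobolev_graph 2 K. \<forall>y\<in>sobolev_graph 2 K.
        sat_bcs K J \<alpha> \<beta> \<gamma> \<delta> x \<longrightarrow> sat_bcs K J \<alpha> \<beta> \<gamma> \<delta> y \<longrightarrow>
        graph_inner K (diff_expr q x) y = graph_inner K x (diff_expr q y))"

definition dom_F :: "nat \<Rightarrow> nat \<Rightarrow> coeffs \<Rightarrow> coeffs \<Rightarrow> graph_fun set" where
  "dom_F K J \<alpha> \<gamma> = {y \<in> sobolev_graph 1 K. sat_I K J \<alpha> \<gamma> y}"

text \<open>Only the values \<open>f i 0\<close> and \<open>f i 1\<close>, one scalar for each edge end, enter the boundary
  integral.\<close>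
definition co_normal ::
  "nat \<Rightarrow> nat \<Rightarrow> coeffs \<Rightarrow> coeffs \<Rightarrow> coeffs \<Rightarrow> coeffs \<Rightarrow> bool" where
  "co_normal K J \<alpha> \<beta> \<gamma> \<delta> \<longleftrightarrow>
     (\<exists>f :: nat \<Rightarrow> real \<Rightarrow> complex. \<forall>x \<in> dom_F K J \<alpha> \<gamma> \<inter> sobolev_graph 2 K.
        (\<forall>y \<in> dom_F K J \<alpha> \<gamma>.
           boundary_integral K (\<lambda>i t. (f i t * x i t + edge_deriv (x i) t) * cnj (y i t)) = 0)
        \<longleftrightarrow> sat_II K J \<alpha> \<beta> \<gamma> \<delta> x)"

subsection \<open>The operator and the eigenvalue problem\<close>

definition dom_L ::
  "nat \<Rightarrow> (nat \<Rightarrow> real \<Rightarrow> real) \<Rightarrow> nat \<Rightarrow> coeffs \<Rightarrow> coeffs \<Rightarrow> coeffs \<Rightarrow> coeffs \<Rightarrow> graph_fun set" where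
  "dom_L K q J \<alpha> \<beta> \<gamma> \<delta> =
     {f. (\<forall>i\<in>{1..K}. abs_cont_on {0..1} (f i) \<and> f i differentiable_on {0..1} \<and>
                     abs_cont_on {0..1} (edge_deriv (f i))) \<and>
         diff_expr q f \<in> L2_graph K \<and> sat_bcs K J \<alpha> \<beta> \<gamma> \<delta> f}"

definition L_positive_definite ::
  "nat \<Rightarrow> (nat \<Rightarrow> real \<Rightarrow> real) \<Rightarrow> nat \<Rightarrow> coeffs \<Rightarrow> coeffs \<Rightarrow> coeffs \<Rightarrow> coeffs \<Rightarrow> bool" where
  "L_positive_definite K q J \<alpha> \<beta> \<gamma> \<delta> \<longleftrightarrow>
     (\<forall>y\<in>dom_L K q J \<alpha> \<beta> \<gamma> \<delta>. \<not> zero_graph_fun K y \<longrightarrow> 0 < graph_inner K (diff_expr q y) y)"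

definition is_eigenfunction ::
  "nat \<Rightarrow> nat \<Rightarrow> (nat \<Rightarrow> real \<Rightarrow> real) \<Rightarrow> nat \<Rightarrow> coeffs \<Rightarrow> coeffs \<Rightarrow> coeffs \<Rightarrow> coeffs \<Rightarrow>
     complex \<Rightarrow> graph_fun \<Rightarrow> bool" where
  "is_eigenfunction K p q J \<alpha> \<beta> \<gamma> \<delta> lam y \<longleftrightarrow>
     y \<in> sobolev_graph 2 K \<and> \<not> zero_graph_fun K y \<and>
     (\<forall>i\<in>{1..K}. AE t in lebesgue_on {0..1}. diff_expr q y i t = lam * weight_op p y i t) \<and>
     sat_bcs K J \<alpha> \<beta> \<gamma> \<delta> y"

end

theory Submission
  imports Defs
begin

text \<open>
  Pairing the equation \<open>ly = \<lambda>By\<close> with \<open>y\<close> itself gives \<open>(ly, y) = \<lambda>(By, y) = \<lambda>[y, y]\<close>.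
  Since \<open>y\<close> is a nonzero element of the domain of \<open>L\<close>, the left-hand side is positive, while
  \<open>[y, y]\<close> is real because \<open>b\<close> is real. Hence \<open>[y, y] \<noteq> 0\<close>, the eigenvalue is real, and \<open>\<lambda>\<close> and
  \<open>[y, y]\<close> have the same sign.

  What remains is to see that \<open>y\<close> does lie in \<open>L\<^sup>2\<close> and in the domain of \<open>L\<close>: the former holds
  because \<open>y\<close> is continuous on each compact edge (\<open>L2_edge_continuous\<close>), and for the latter the
  square integrability of \<open>ly\<close> is inherited from \<open>\<lambda>By\<close> through the equation (\<open>L2_edge_cong_AE\<close>).
\<close>

lemma L2_edge_continuous:
  assumes "continuous_on {0..1} f"
  shows "L2_edge f"
proof -
  have "f \<in> borel_measurable (lebesgue_on {0..1})"
    by (rule continuous_imp_measurable_on_sets_lebesgue[OF assms]) simp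
  moreover have "continuous_on {0..1} (\<lambda>t. (cmod (f t))\<^sup>2)"
    by (intro continuous_intros assms)
  then have "integrable (lebesgue_on {0..1}) (\<lambda>t. (cmod (f t))\<^sup>2)"
    using continuous_imp_integrable_real by blast
  ultimately show ?thesis
    unfolding L2_edge_def by simp
qed

lemma L2_edge_cmult:
  assumes "L2_edge f"
  shows "L2_edge (\<lambda>t. c * f t)"
  using assms unfolding L2_edge_def by (auto simp: norm_mult power_mult_distrib)

lemma L2_edge_cong_AE:
  assumes "L2_edge g"
    and "f \<in> borel_measurable (lebesgue_on {0..1})"
    and "AE t in lebesgue_on {0..1}. f t = g t"
  shows "L2_edge f"
proof -
  have "integrable (lebesgue_on {0..1}) (\<lambda>t. (cmod (g t))\<^sup>2)"
    using assms(1) unfolding L2_edge_def by simp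
  then have "integrable (lebesgue_on {0..1}) (\<lambda>t. (cmod (f t))\<^sup>2)"
  proof (rule integrable_cong_AE_imp)
    show "(\<lambda>t. (cmod (f t))\<^sup>2) \<in> borel_measurable (lebesgue_on {0..1})"
      using assms(2) by measurable
    show "AE t in lebesgue_on {0..1}. (cmod (g t))\<^sup>2 = (cmod (f t))\<^sup>2"
      using assms(3) by eventually_elim simp
  qed
  then show ?thesis
    using assms(2) unfolding L2_edge_def by simp
qed

lemma sobolev_edge_2D:
  assumes "sobolev_edge 2 f"
  shows "abs_cont_on {0..1} f" "abs_cont_on {0..1} (edge_deriv f)"
    "f differentiable_on {0..1}" "L2_edge (edge_deriv (edge_deriv f))"
proof -
  have ac: "abs_cont_on {0..1} ((edge_deriv ^^ j) f)" if "j < 2" for j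
    using assms that unfolding sobolev_edge_def by blast
  have diff: "(edge_deriv ^^ j) f differentiable_on {0..1}" if "Suc j < 2" for j
    using assms that unfolding sobolev_edge_def by blast
  show "abs_cont_on {0..1} f" "abs_cont_on {0..1} (edge_deriv f)" "f differentiable_on {0..1}"
    using ac[of 0] ac[of 1] diff[of 0] by simp_all
  show "L2_edge (edge_deriv (edge_deriv f))"
    using assms unfolding sobolev_edge_def by (simp add: numeral_2_eq_2)
qed

lemma sobolev_edge_2_imp_L2_edge:
  assumes "sobolev_edge 2 f"
  shows "L2_edge f"
  by (rule L2_edge_continuous)
    (rule differentiable_imp_continuous_on[OF sobolev_edge_2D(3)[OF assms]])

lemma krein_inner_self_real: "krein_inner p K y y \<in> \<real>"
proof -
  have "weight_op p y i t * cnj (y i t)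
      = complex_of_real ((if i \<le> p then 1 else - 1) * (cmod (y i t))\<^sup>2)" for i t
    by (simp add: weight_op_def complex_norm_square mult.assoc del: of_real_power)
  then show ?thesis
    unfolding krein_inner_def graph_inner_def graph_integral_def
    by (simp only: integral_complex_of_real) (intro sum_in_Reals Reals_of_real)
qed

lemma diff_expr_measurable:
  assumes "ess_bounded K q" and "y \<in> sobolev_graph 2 K" and "i \<in> {1..K}"
  shows "diff_expr q y i \<in> borel_measurable (lebesgue_on {0..1})"
proof -
  have "sobolev_edge 2 (y i)"
    using assms by (auto simp: sobolev_graph_def)
  from sobolev_edge_2D(4)[OF this] sobolev_edge_2_imp_L2_edge[OF this]
  have [measurable]: "y i \<in> borel_measurable (lebesgue_on {0..1})"
    "edge_deriv (edge_deriv (y i)) \<in> borel_measurable (lebesgue_on {0..1})"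
    by (simp_all add: L2_edge_def)
  have [measurable]: "q i \<in> borel_measurable (lebesgue_on {0..1})"
    using assms by (auto simp: ess_bounded_def)
  show ?thesis
    unfolding diff_expr_def by measurable
qed

lemma eigenfunction_in_L2_graph:
  assumes "is_eigenfunction K p q J \<alpha> \<beta> \<gamma> \<delta> lam y"
  shows "y \<in> L2_graph K"
  using assms sobolev_edge_2_imp_L2_edge
  by (auto simp: is_eigenfunction_def sobolev_graph_def L2_graph_def)

lemma weight_op_in_L2_graph:
  assumes "y \<in> L2_graph K"
  shows "weight_op p y \<in> L2_graph K"
  unfolding L2_graph_def weight_op_def
  using assms by (auto simp only: L2_graph_def mem_Collect_eq intro!: L2_edge_cmult)

lemma eigenfunction_in_dom_L:
  assumes "ess_bounded K q"
    and "is_eigenfunction K p q J \<alpha> \<beta> \<gamma> \<delta> lam y"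
  shows "y \<in> dom_L K q J \<alpha> \<beta> \<gamma> \<delta>"
proof -
  have sob: "y \<in> sobolev_graph 2 K"
    and eq: "\<And>i. i \<in> {1..K} \<Longrightarrow>
      AE t in lebesgue_on {0..1}. diff_expr q y i t = lam * weight_op p y i t"
    and bcs: "sat_bcs K J \<alpha> \<beta> \<gamma> \<delta> y"
    using assms(2) by (auto simp: is_eigenfunction_def)
  have "L2_edge (diff_expr q y i)" if "i \<in> {1..K}" for i
  proof (rule L2_edge_cong_AE[OF _ diff_expr_measurable[OF assms(1) sob that] eq[OF that]])
    show "L2_edge (\<lambda>t. lam * weight_op p y i t)"
      using weight_op_in_L2_graph[OF eigenfunction_in_L2_graph[OF assms(2)]] that
      by (auto simp: L2_graph_def intro!: L2_edge_cmult)
  qed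
  then show ?thesis
    using sob bcs by (auto simp: dom_L_def L2_graph_def sobolev_graph_def dest: sobolev_edge_2D)
qed

lemma eigenfunction_energy:
  assumes "ess_bounded K q"
    and "is_eigenfunction K p q J \<alpha> \<beta> \<gamma> \<delta> lam y"
  shows "graph_inner K (diff_expr q y) y = lam * krein_inner p K y y"
proof -
  have sob: "y \<in> sobolev_graph 2 K"
    and eq: "\<And>i. i \<in> {1..K} \<Longrightarrow>
      AE t in lebesgue_on {0..1}. diff_expr q y i t = lam * weight_op p y i t"
    using assms(2) by (auto simp: is_eigenfunction_def)
  have "(\<integral>t. diff_expr q y i t * cnj (y i t) \<partial>lebesgue_on {0..1})
      = lam * (\<integral>t. weight_op p y i t * cnj (y i t) \<partial>lebesgue_on {0..1})"
    if i: "i \<in> {1..K}" for i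
  proof -
    have [measurable]: "diff_expr q y i \<in> borel_measurable (lebesgue_on {0..1})"
      by (rule diff_expr_measurable[OF assms(1) sob i])
    have [measurable]: "y i \<in> borel_measurable (lebesgue_on {0..1})"
      using eigenfunction_in_L2_graph[OF assms(2)] i by (auto simp: L2_graph_def L2_edge_def)
    have [measurable]: "weight_op p y i \<in> borel_measurable (lebesgue_on {0..1})"
      unfolding weight_op_def by measurable
    have [measurable]: "(\<lambda>t. cnj (y i t)) \<in> borel_measurable (lebesgue_on {0..1})"
      by (rule borel_measurable_continuous_on[OF continuous_on_cnj[OF continuous_on_id]]) measurable
    have "(\<integral>t. diff_expr q y i t * cnj (y i t) \<partial>lebesgue_on {0..1})
        = (\<integral>t. lam * (weight_op p y i t * cnj (y i t)) \<partial>lebesgue_on {0..1})"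
    proof (rule integral_cong_AE)
      show "AE t in lebesgue_on {0..1}.
          diff_expr q y i t * cnj (y i t) = lam * (weight_op p y i t * cnj (y i t))"
        using eq[OF i] by eventually_elim simp
    qed measurable
    then show ?thesis
      by simp
  qed
  then show ?thesis
    by (simp add: graph_inner_def krein_inner_def graph_integral_def sum_distrib_left)
qed

lemma mult_Real_pos_iff_complex:
  fixes z r :: complex
  assumes "r \<in> \<real>" and "0 < z * r"
  shows "0 < r \<longleftrightarrow> 0 < z" and "r < 0 \<longleftrightarrow> z < 0"
proof -
  obtain a where r: "r = complex_of_real a"
    using assms(1) by (auto elim: Reals_cases)
  have pos: "0 < Re z * a" and im: "Im z = 0"
    using assms(2) by (auto simp: r less_complex_def)
  show "0 < r \<longleftrightarrow> 0 < z" "r < 0 \<longleftrightarrow> z < 0"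
    using pos im by (auto simp: r less_complex_def zero_less_mult_iff)
qed

theorem theorem4p3:
  fixes G :: "('v, nat) pre_digraph"
    and K p J :: nat
    and q :: "nat \<Rightarrow> real \<Rightarrow> real"
    and \<alpha> \<beta> \<gamma> \<delta> :: coeffs
    and lam :: complex
    and y :: graph_fun
  assumes "wf_digraph G" and "arcs G = {1..K}"
    and "p \<le> K"
    and "ess_bounded K q"
    and "graph_bcs G K J \<alpha> \<beta> \<gamma> \<delta>"
    and "formally_self_adjoint K q J \<alpha> \<beta> \<gamma> \<delta>"
    and "co_normal K J \<alpha> \<beta> \<gamma> \<delta>"
    and "L_positive_definite K q J \<alpha> \<beta> \<gamma> \<delta>"
    and "is_eigenfunction K p q J \<alpha> \<beta> \<gamma> \<delta> lam y"
  shows "(y \<in> cone_pos p K \<longleftrightarrow> 0 < lam) \<and> (y \<in> cone_neg p K \<longleftrightarrow> lam < 0)"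
proof -
  have "\<not> zero_graph_fun K y"
    using assms(9) by (simp add: is_eigenfunction_def)
  then have "0 < graph_inner K (diff_expr q y) y"
    using assms(8) eigenfunction_in_dom_L[OF assms(4,9)] by (simp add: L_positive_definite_def)
  then have "0 < lam * krein_inner p K y y"
    by (simp only: eigenfunction_energy[OF assms(4,9)])
  from mult_Real_pos_iff_complex[OF krein_inner_self_real this]
  show ?thesis
    using eigenfunction_in_L2_graph[OF assms(9)] by (simp add: cone_pos_def cone_neg_def)
qed

end
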